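(* Suppose that $\theta,\kappa$ are infinite regular cardinals with $\kappa>2^\theta$. If $\kappa$ carries a uniform ultrafilter that is $\mu$-indecomposable for every cardinal $\mu\in[\theta,\kappa)$, then there exists a cardinal $\mu<\theta$ such that $\chi(\vec C)\le\mu$ for every transversal $\vec C$ for $\square(\kappa,{<}\kappa)$.
   Context: For a set of ordinals $A$, $\mathrm{acc}(A)=\{\alpha\in A\mid\sup(A\cap\alpha)=\alpha>0\}$. A $\square(\kappa,{<}\kappa)$-sequence is a sequence $\langle\mathcal C_\alpha\mid\alpha<\kappa\rangle$ such that each $\mathcal C_\alpha$ is a nonempty family of fewer than $\kappa$ closed subsets $C$ of $\alpha$ with $\sup(C)=\sup(\alpha)$; for every $C\in\mathcal C_\alpha$ and $\bar\alpha\in\mathrm{acc}(C)$, $C\cap\bar\alpha\in\mathcal C_{\bar\alpha}$; and there is no club $D\subseteq\kappa$ with $D\cap\alpha\in\mathcal C_\alpha$ for all $\alpha\in\mathrm{acc}(D)$. A transversal for $\square(\kappa,{<}\kappa)$ is a sequence $\langle C_\alpha\mid\alpha<\kappa\rangle$ with $C_\alpha\in\mathcal C_\alpha$ for all $\alpha$, for some $\square(\kappa,{<}\kappa)$-sequence $\langle\mathcal C_\alpha\mid\alpha<\kappa\rangle$. For a sequence $\vec C=\langle C_\beta\mid\beta<\kappa\rangle$, $\chi(\vec C)$ is the least cardinal $\chi\le\kappa$ such that there exist $\Delta\in[\kappa]^\kappa$ and $b:\kappa\to[\kappa]^\chi$ with $\Delta\cap\alpha\subseteq\bigcup_{\beta\in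 b(\alpha)}C_\beta$ for every $\alpha<\kappa$. An ultrafilter $U$ over $\kappa$ is uniform if all its members have size $\kappa$; it is $\mu$-indecomposable if for every $f:\kappa\to\mu$ there is $H\subseteq\mu$ with $|H|<\mu$ and $f^{-1}[H]\in U$. *)

theory Defs
  imports Main
begin

unbundle cardinal_syntax

text \<open>Ordinals below kappa are modelled by the elements of a well-ordered type 'a
whose order type is kappa (see kappa_type below). An ordinal alpha is identified
with the set of smaller ordinals; so for a set A of ordinals, A \<inter> alpha is
{x \<in> A. x < alpha}.\<close>

definition ozero :: "'a::wellorder" where
  "ozero = (LEAST x. True)"

text \<open>Supremum of a (bounded) set of ordinals: least upper bound (osup {} = 0).\<close>
definition osup :: "'a::wellorder set \<Rightarrow> 'a" where
  "osup A = (LEAST g. \<forall>x\<in>A. x \<le> g)"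

definition osup_ord :: "'a::wellorder \<Rightarrow> 'a" where
  "osup_ord a = osup {x. x < a}"

definition acc :: "'a::wellorder set \<Rightarrow> 'a set" where
  "acc A = {a \<in> A. osup {x \<in> A. x < a} = a \<and> ozero < a}"

definition closed_below :: "'a::wellorder set \<Rightarrow> 'a \<Rightarrow> bool" where
  "closed_below C a \<longleftrightarrow> C \<subseteq> {x. x < a} \<and>
     (\<forall>b < a. osup {x \<in> C. x < b} = b \<and> ozero < b \<longrightarrow> b \<in> C)"

definition club :: "'a::wellorder set \<Rightarrow> bool" where
  "club D \<longleftrightarrow> (\<forall>b. osup {x \<in> D. x < b} = b \<and> ozero < b \<longrightarrow> b \<in> D) \<and>
     (\<forall>x. \<exists>y\<in>D. x \<le> y)"

definition kappa_type :: "'a::wellorder itself \<Rightarrow> bool" where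
  "kappa_type _ \<longleftrightarrow> infinite (UNIV::'a set) \<and>
     (\<forall>x::'a. |{y. y < x}| <o |(UNIV::'a set)| ) \<and> regularCard |(UNIV::'a set)|"

definition square_seq :: "('a::wellorder \<Rightarrow> 'a set set) \<Rightarrow> bool" where
  "square_seq CC \<longleftrightarrow>
     (\<forall>a. CC a \<noteq> {} \<and> |CC a| <o |(UNIV::'a set)| \<and>
          (\<forall>C\<in>CC a. closed_below C a \<and> osup C = osup_ord a) \<and>
          (\<forall>C\<in>CC a. \<forall>b\<in>acc C. {x \<in> C. x < b} \<in> CC b)) \<and>
     \<not> (\<exists>D. club D \<and> (\<forall>a\<in>acc D. {x \<in> D. x < a} \<in> CC a))"

definition transversal :: "('a::wellorder \<Rightarrow> 'a set) \<Rightarrow> bool" where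
  "transversal C \<longleftrightarrow> (\<exists>CC. square_seq CC \<and> (\<forall>a. C a \<in> CC a))"

definition chi_witness :: "('a::wellorder \<Rightarrow> 'a set) \<Rightarrow> 'a set \<Rightarrow> bool" where
  "chi_witness C X \<longleftrightarrow> (\<exists>(Delta::'a set) (b::'a \<Rightarrow> 'a set).
     |Delta| =o |(UNIV::'a set)| \<and>
     (\<forall>a. |b a| =o |X| \<and> {x \<in> Delta. x < a} \<subseteq> (\<Union>beta\<in>b a. C beta)))"

text \<open>chi(C) \<le> |M|: the least cardinal chi admitting a witness is \<le> |M|,
  i.e. some cardinal \<le> |M| admits a witness.\<close>
definition chi_le :: "('a::wellorder \<Rightarrow> 'a set) \<Rightarrow> 'a set \<Rightarrow> bool" where
  "chi_le C M \<longleftrightarrow> (\<exists>X. |X| \<le>o |M| \<and> chi_witness C X)"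

definition ultrafilter_on :: "'a set set \<Rightarrow> bool" where
  "ultrafilter_on U \<longleftrightarrow> UNIV \<in> U \<and> {} \<notin> U \<and>
     (\<forall>A B. A \<in> U \<and> A \<subseteq> B \<longrightarrow> B \<in> U) \<and>
     (\<forall>A B. A \<in> U \<and> B \<in> U \<longrightarrow> A \<inter> B \<in> U) \<and>
     (\<forall>A. A \<in> U \<or> - A \<in> U)"

definition uniform_uf :: "'a set set \<Rightarrow> bool" where
  "uniform_uf U \<longleftrightarrow> ultrafilter_on U \<and> (\<forall>A\<in>U. card_of A =o |(UNIV::'a set)| )"

definition indecomposable :: "'a set set \<Rightarrow> 'b set \<Rightarrow> bool" where
  "indecomposable U M \<longleftrightarrow> (\<forall>f. f ` UNIV \<subseteq> M \<longrightarrow>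
     (\<exists>H \<subseteq> M. |H| <o |M| \<and> f -` H \<in> U))"

end

(* Indecomposability gives a map p with fewer than theta values through which every map with fewer
   than kappa values factors modulo U. From this one gets a least function that is unbounded modulo
   U, even though the ultrapower may be ill-founded; replacing U by its image under that function,
   regressive functions become bounded modulo U. Then unboundedly many ordinals c of cofinality at
   least theta are accumulation points of U-almost every C_b. There are fewer than kappa possible
   traces of the C_b on c, so the trace factors through p, and |range p| many of the C_b cover all
   such ordinals below c. The bound |range p| does not depend on the transversal. *)

theory Submission
  imports Defs
begin

section \<open>Cardinals, descending values and suprema\<close>

lemma finite_card_less:
  assumes "finite A" "infinite B"
  shows "|A| <o |B|"
  using assms card_of_ordLeq_finite[of B A]
    not_ordLess_iff_ordLeq[OF card_of_Well_order card_of_Well_order, of A B] by blast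

lemma card_less_subset: "A \<subseteq> B \<Longrightarrow> |B| <o r \<Longrightarrow> |A| <o r"
  by (rule ordLeq_ordLess_trans[OF card_of_mono1])

text \<open>An infinite \<open>S\<close> would give an infinite descent of values. The induction is
  on the value \<open>f i\<close>: passing from \<open>i\<close> to the next element
  \<open>k\<close> of \<open>S\<close> lowers the value and drops only \<open>i\<close> from the
  tail.\<close>

lemma finite_if_strictly_decreasing:
  fixes f :: "'a::wellorder \<Rightarrow> 'b::wellorder"
  assumes dec: "\<And>i j. i \<in> S \<Longrightarrow> j \<in> S \<Longrightarrow> i < j \<Longrightarrow> f j < f i"
  shows "finite S"
proof (cases "S = {}")
  case False
  have fin: "finite {j \<in> S. i \<le> j}" if "i \<in> S" for i
    using that
  proof (induction "f i" arbitrary: i rule: less_induct)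
    case less
    show ?case
    proof (cases "\<exists>j\<in>S. i < j")
      case True
      define k where "k = (LEAST j. j \<in> S \<and> i < j)"
      have k: "k \<in> S" "i < k"
        using True LeastI_ex[of "\<lambda>j. j \<in> S \<and> i < j"] by (auto simp: k_def)
      have "k \<le> j" if "j \<in> S" "i < j" for j
        using that by (auto simp: k_def intro: Least_le)
      then have "{j \<in> S. i \<le> j} \<subseteq> insert i {j \<in> S. k \<le> j}"
        by (auto dest: le_imp_less_or_eq)
      moreover have "finite {j \<in> S. k \<le> j}"
        using less k dec by blast
      ultimately show ?thesis
        using finite_subset by blast
    next
      case False
      then have "{j \<in> S. i \<le> j} \<subseteq> {i}" by (auto dest: le_imp_less_or_eq)
      then show ?thesis using finite_subset by blast
    qed
  qed
  define m where "m = (LEAST i. i \<in> S)"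
  have "m \<in> S" using False by (auto simp: m_def intro: LeastI)
  moreover have "S = {j \<in> S. m \<le> j}" by (auto simp: m_def intro: Least_le)
  ultimately show ?thesis using fin by metis
qed simp

text \<open>Needed because \<open>chi_witness\<close> asks for index sets of size exactly
  \<open>|X|\<close>, while covers are found with an upper bound on their size only.\<close>

lemma superset_of_cardinality:
  fixes B X :: "'a set"
  assumes "|B| \<le>o |X|" "infinite (UNIV::'a set)"
  shows "\<exists>B'. B \<subseteq> B' \<and> |B'| =o |X|"
proof (cases "finite X")
  case True
  then have B: "finite B" "card B \<le> card X"
    using assms(1) card_of_ordLeq_finite card_of_ordLeq[of B X] card_inj_on_le by blast+
  have "infinite (UNIV - B)" using assms(2) B(1) by simp
  then obtain D where D: "finite D" "card D = card X - card B" "D \<subseteq> UNIV - B"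
    using infinite_arbitrarily_large by blast
  have "B \<inter> D = {}" using D(3) by blast
  then have "card (B \<union> D) = card X"
    using B D by (simp add: card_Un_disjoint)
  then have "|B \<union> D| =o |X|"
    using B(1) D(1) True finite_same_card_bij card_of_ordIso by (metis finite_UnI)
  then show ?thesis by blast
next
  case False
  have "|B \<union> X| \<le>o |X|"
    using assms(1) False
    by (intro card_of_Un_ordLeq_infinite_Field[OF _ _ _ card_of_Card_order])
      (simp_all add: Field_card_of card_of_mono1)
  then have "|B \<union> X| =o |X|"
    by (simp add: card_of_mono1 ordIso_iff_ordLeq)
  then show ?thesis by blast
qed

lemma osup_le: "(\<And>x. x \<in> A \<Longrightarrow> x \<le> g) \<Longrightarrow> osup A \<le> g"
  unfolding osup_def by (rule Least_le) blast

text \<open>The bound \<open>g\<close> makes the \<open>LEAST\<close> in \<open>osup\<close>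
  exist.\<close>

lemma osup_upper:
  assumes "x \<in> A" "\<And>x. x \<in> A \<Longrightarrow> x \<le> g"
  shows "x \<le> osup A"
  using LeastI[of "\<lambda>g. \<forall>x\<in>A. x \<le> g" g] assms unfolding osup_def by blast

section \<open>Indecomposable ultrafilters over kappa\<close>

text \<open>\<open>T\<close> stands for theta. The ultrafilter is a \<open>filter\<close>, so that
  "almost everywhere" is \<open>eventually\<close> and images are \<open>filtermap\<close>.
  Uniformity enters as \<open>unbounded\<close>, a form that passes to images under functions
  unbounded modulo \<open>F\<close>.\<close>

locale indecomposable_filter =
  fixes T :: "'a::wellorder set" and F :: "'a filter"
  assumes kappa: "kappa_type TYPE('a)"
    and infinite_T: "infinite T"
    and regular_T: "regularCard |T|"
    and Pow_T: "|Pow T| <o |UNIV::'a set|"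
    and nontrivial: "F \<noteq> bot"
    and ultra: "(\<forall>\<^sub>F x in F. P x) \<or> (\<forall>\<^sub>F x in F. \<not> P x)"
    and unbounded: "\<forall>\<^sub>F x in F. y < x"
    and indecomposable: "|T| \<le>o |M::'a set| \<Longrightarrow> |M| <o |UNIV::'a set| \<Longrightarrow> range (f::'a \<Rightarrow> 'a) \<subseteq> M \<Longrightarrow>
      \<exists>H::'a set. |H| <o |M| \<and> (\<forall>\<^sub>F x in F. f x \<in> H)"
begin

lemma infinite_UNIV: "infinite (UNIV::'a set)"
  using kappa by (simp add: kappa_type_def)

lemma T_less: "|T| <o |UNIV::'a set|"
  by (rule ordLess_transitive[OF card_of_Pow Pow_T])

text \<open>Regularity of kappa: otherwise \<open>S\<close> and fewer than kappa initial segments,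
  each of size less than kappa, would exhaust the type.\<close>

lemma small_bounded:
  fixes S :: "'a set"
  assumes "|S| <o |UNIV::'a set|"
  shows "\<exists>y. \<forall>s\<in>S. s < y"
proof (rule ccontr)
  assume "\<not> ?thesis"
  then have *: "\<exists>s\<in>S. y \<le> s" for y
    by (meson not_le)
  have "stable |UNIV::'a set|"
    using kappa infinite_UNIV
    by (intro regularCard_stable[OF card_of_Card_order]) (simp_all add: kappa_type_def Field_card_of)
  then have "|\<Union>s\<in>S. {y. y < s}| <o |UNIV::'a set|"
    using assms kappa infinite_UNIV
    by (intro card_of_UNION_ordLess_infinite) (auto simp: kappa_type_def)
  then have "|S \<union> (\<Union>s\<in>S. {y. y < s})| <o |UNIV::'a set|"
    using assms infinite_UNIV by (intro card_of_Un_ordLess_infinite)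
  moreover have "S \<union> (\<Union>s\<in>S. {y. y < s}) = UNIV"
    using * by (auto simp: le_less)
  ultimately show False
    by (simp add: ordLess_irreflexive)
qed

lemma small_index_bounded:
  assumes "|I| <o |UNIV::'a set|"
  shows "\<exists>y::'a. \<forall>i\<in>I. g i < y"
  using small_bounded[of "g ` I"] ordLeq_ordLess_trans[OF card_of_image assms] by auto

lemma exists_greater: "\<exists>y. (x::'a) < y"
  using small_bounded[of "{x}"] finite_card_less[OF _ infinite_UNIV, of "{x}"] by auto

lemma unbounded_full:
  fixes S :: "'a set"
  assumes "\<And>y. \<exists>s\<in>S. y \<le> s"
  shows "|S| =o |UNIV::'a set|"
proof -
  have "\<not> |S| <o |UNIV::'a set|"
    using small_bounded assms by (meson not_le)
  then show ?thesis
    by (meson card_of_Well_order card_of_mono1 not_ordLess_iff_ordLeq ordIso_iff_ordLeq subset_UNIV)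
qed

section \<open>Maps with few values and the finest partition\<close>

text \<open>Take \<open>V\<close> of least cardinality among the sets of values that contain
  \<open>h x\<close> almost everywhere. If \<open>|T| \<le>o |V|\<close>, indecomposability at
  \<open>|V|\<close>, which is below kappa, would shrink it further.\<close>

lemma few_values:
  fixes h :: "'a \<Rightarrow> 'b"
  assumes small: "|range h| <o |UNIV::'a set|"
  obtains V where "|V| <o |T|" "V \<subseteq> range h" "\<forall>\<^sub>F x in F. h x \<in> V"
proof -
  define R where "R = {|V| | V. V \<subseteq> range h \<and> (\<forall>\<^sub>F x in F. h x \<in> V)}"
  have "|range h| \<in> R"
    unfolding R_def by (auto intro!: exI[of _ "range h"])
  then have "R \<noteq> {}" by blast
  moreover have "\<forall>r\<in>R. Card_order r"
    unfolding R_def by (auto simp: card_of_Card_order)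
  ultimately obtain V where V: "V \<subseteq> range h" "\<forall>\<^sub>F x in F. h x \<in> V"
    and least: "\<And>W. W \<subseteq> range h \<Longrightarrow> \<forall>\<^sub>F x in F. h x \<in> W \<Longrightarrow> |V| \<le>o |W|"
    using exists_minim_Card_order[of R] unfolding R_def by blast
  have "|V| <o |T|"
  proof (rule ccontr)
    assume "\<not> |V| <o |T|"
    then have TV: "|T| \<le>o |V|"
      by (simp add: card_of_Well_order not_ordLess_iff_ordLeq)
    have Vs: "|V| <o |UNIV::'a set|"
      using card_of_mono1[OF V(1)] small ordLeq_ordLess_trans by blast
    then obtain e :: "'b \<Rightarrow> 'a" where e: "inj_on e V"
      using card_of_ordLeq[of V "UNIV::'a set"] ordLess_imp_ordLeq by blast
    then have iso: "|V| =o |e ` V|"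
      using card_of_ordIso inj_on_imp_bij_betw by blast
    obtain v where v: "v \<in> V"
      using infinite_T TV card_of_empty3 by fastforce
    define f where "f x = (if h x \<in> V then e (h x) else e v)" for x
    have "\<exists>H. |H| <o |e ` V| \<and> (\<forall>\<^sub>F x in F. f x \<in> H)"
    proof (rule indecomposable)
      show "|T| \<le>o |e ` V|" using TV iso ordLeq_ordIso_trans by blast
      show "|e ` V| <o |UNIV::'a set|" using Vs iso ordIso_symmetric ordIso_ordLess_trans by blast
      show "range f \<subseteq> e ` V" using v by (auto simp: f_def)
    qed
    then obtain H where H: "|H| <o |e ` V|" "\<forall>\<^sub>F x in F. f x \<in> H" by blast
    define W where "W = {w \<in> V. e w \<in> H}"
    have "|W| \<le>o |H|"
      using e by (intro card_of_ordLeqI[of e]) (auto simp: W_def inj_on_def)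
    then have "|W| <o |V|"
      using H(1) iso ordLeq_ordLess_trans ordLess_ordIso_trans ordIso_symmetric by blast
    moreover have "|V| \<le>o |W|"
    proof (rule least)
      show "W \<subseteq> range h" using V(1) by (auto simp: W_def)
      show "\<forall>\<^sub>F x in F. h x \<in> W"
        using V(2) H(2) by eventually_elim (auto simp: W_def f_def)
    qed
    ultimately show False
      using not_ordLess_ordLeq by blast
  qed
  with V show thesis using that by blast
qed

text \<open>The hypothesis on \<open>p\<close> covers only maps into \<open>T\<close>. By
  \<open>few_values\<close> an injection \<open>e\<close> into \<open>T\<close> encodes almost all
  values of \<open>h\<close>, and its inverse decodes what \<open>p\<close> determines.\<close>

lemma factor_small_range:
  fixes h :: "'a \<Rightarrow> 'b" and p :: "'a \<Rightarrow> 'c"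
  assumes p: "\<And>f::'a \<Rightarrow> 'a. range f \<subseteq> T \<Longrightarrow> \<exists>g. \<forall>\<^sub>F x in F. f x = g (p x)"
    and h: "|range h| <o |UNIV::'a set|"
  shows "\<exists>g. \<forall>\<^sub>F x in F. h x = g (p x)"
proof -
  obtain V where V: "|V| <o |T|" "\<forall>\<^sub>F x in F. h x \<in> V"
    using few_values[OF h] by blast
  obtain e where e: "inj_on e V" "e ` V \<subseteq> T"
    using V(1) card_of_ordLeq[of V T] ordLess_imp_ordLeq by blast
  obtain t where t: "t \<in> T" using infinite_T by fastforce
  define f where "f x = (if h x \<in> V then e (h x) else t)" for x
  have "range f \<subseteq> T" using e t by (auto simp: f_def)
  then obtain g where g: "\<forall>\<^sub>F x in F. f x = g (p x)" using p by blast
  have "\<forall>\<^sub>F x in F. h x = (inv_into V e \<circ> g) (p x)"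
    using g V(2)
  proof eventually_elim
    case (elim x)
    then have "inv_into V e (g (p x)) = inv_into V e (e (h x))"
      by (simp add: f_def flip: elim(1))
    then show ?case using e(1) elim(2) by simp
  qed
  then show ?thesis by blast
qed

lemma Pow_small:
  assumes "|X| \<le>o |T|"
  shows "|Pow X| <o |UNIV::'a set|"
proof -
  obtain e where "inj_on e X" "e ` X \<subseteq> T"
    using assms card_of_ordLeq[of X T] by blast
  then have "|Pow X| \<le>o |Pow T|"
    by (intro card_of_ordLeqI[of "image e"] inj_on_image_Pow) auto
  then show ?thesis using Pow_T ordLeq_ordLess_trans by blast
qed

lemma Times_below_T:
  assumes "|V| <o |T|"
  shows "|V \<times> V| <o |T|"
proof (cases "finite V")
  case True
  then show ?thesis using infinite_T by (simp add: finite_card_less)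
next
  case False
  then show ?thesis
    using assms card_of_Times_same_infinite ordIso_ordLess_trans by blast
qed

text \<open>Otherwise recursion along T yields functions none of which is determined almost everywhere by
  the earlier ones. Jointly they take fewer than |T| values almost everywhere, yet each of them
  separates a pair of these values that no earlier one separates.\<close>
lemma finest_partition:
  obtains p :: "'a \<Rightarrow> 'a" where "|range p| <o |T|"
    "\<And>h::'a \<Rightarrow> 'a. range h \<subseteq> T \<Longrightarrow> \<exists>g. \<forall>\<^sub>F x in F. h x = g (p x)"
proof -
  have "\<exists>p::'a \<Rightarrow> ('a \<times> 'a) set. |range p| <o |T| \<and>
    (\<forall>h::'a \<Rightarrow> 'a. range h \<subseteq> T \<longrightarrow> (\<exists>g. \<forall>\<^sub>F x in F. h x = g (p x)))"
  proof (rule ccontr)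
    assume none: "\<not> ?thesis"
    \<comment> \<open>\<open>J f I x\<close> is the graph of \<open>j \<mapsto> f j x\<close> on
      \<open>T \<inter> I\<close>, so \<open>J f I\<close> induces the common refinement of the
      partitions given by these \<open>f j\<close>.\<close>
    define J :: "('a \<Rightarrow> 'a \<Rightarrow> 'a) \<Rightarrow> 'a set \<Rightarrow> 'a \<Rightarrow> ('a \<times> 'a) set"
      where "J f I x = (\<lambda>j. (j, f j x)) ` (T \<inter> I)" for f I x
    have J_eq: "J f I x = J f I y \<longleftrightarrow> (\<forall>j\<in>T \<inter> I. f j x = f j y)" for f I x y
      unfolding J_def by (auto simp: set_eq_iff image_iff)
    have J_small: "|range (J f I)| <o |UNIV::'a set|" if "\<And>j. j \<in> I \<Longrightarrow> range (f j) \<subseteq> T" for f I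
    proof -
      have "range (J f I) \<subseteq> Pow (T \<times> T)"
        using that by (fastforce simp: J_def)
      moreover have "|Pow (T \<times> T)| <o |UNIV::'a set|"
        by (intro Pow_small ordIso_imp_ordLeq card_of_Times_same_infinite infinite_T)
      ultimately show ?thesis
        by (rule card_less_subset)
    qed
    define P where "P f i r \<longleftrightarrow> range r \<subseteq> T \<and> \<not> (\<exists>g. \<forall>\<^sub>F x in F. r x = g (J f {..<i} x))"
      for f i and r :: "'a \<Rightarrow> 'a"
    have "\<exists>f. \<forall>i. P f i (f i)"
    proof (rule dependent_wf_choice[OF wf])
      fix f f' :: "'a \<Rightarrow> 'a \<Rightarrow> 'a" and i r
      assume "\<And>j. (j, i) \<in> {(x, y). x < y} \<Longrightarrow> f j = f' j"
      then have "J f {..<i} = J f' {..<i}" by (auto simp: J_def fun_eq_iff)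
      then show "P f i r = P f' i r" by (simp add: P_def)
    next
      fix i and f :: "'a \<Rightarrow> 'a \<Rightarrow> 'a"
      assume "\<And>j. (j, i) \<in> {(x, y). x < y} \<Longrightarrow> P f j (f j)"
      then have "|range (J f {..<i})| <o |UNIV::'a set|"
        by (intro J_small) (simp add: P_def)
      then obtain V where V: "|V| <o |T|" "\<forall>\<^sub>F x in F. J f {..<i} x \<in> V"
        by (rule few_values)
      obtain v where "v \<in> V"
        using eventually_happens[OF V(2)] nontrivial by blast
      \<comment> \<open>Rerouting the exceptional points to \<open>v\<close> leaves fewer than
        \<open>|T|\<close> values everywhere, so \<open>none\<close> applies to
        \<open>p\<close>.\<close>
      define p where "p x = (if J f {..<i} x \<in> V then J f {..<i} x else v)" for x
      have "range p \<subseteq> V" using \<open>v \<in> V\<close> by (auto simp: p_def)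
      then have "|range p| <o |T|"
        using V(1) by (rule card_less_subset)
      then obtain h :: "'a \<Rightarrow> 'a" where h: "range h \<subseteq> T" "\<not> (\<exists>g. \<forall>\<^sub>F x in F. h x = g (p x))"
        using none by blast
      have "\<not> (\<exists>g. \<forall>\<^sub>F x in F. h x = g (J f {..<i} x))"
      proof
        assume "\<exists>g. \<forall>\<^sub>F x in F. h x = g (J f {..<i} x)"
        then obtain g where "\<forall>\<^sub>F x in F. h x = g (J f {..<i} x)" by blast
        then have "\<forall>\<^sub>F x in F. h x = g (p x)"
          using V(2) by eventually_elim (simp add: p_def)
        then show False using h(2) by blast
      qed
      then show "\<exists>r. P f i r" using h(1) by (auto simp: P_def)
    qed
    then obtain f where f: "\<And>i. P f i (f i)" by blast
    have "|range (J f UNIV)| <o |UNIV::'a set|"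
      using f by (intro J_small) (auto simp: P_def)
    then obtain V where V: "|V| <o |T|" "\<forall>\<^sub>F x in F. J f UNIV x \<in> V"
      by (rule few_values)
    \<comment> \<open>Without such a pair, \<open>f i x\<close> would be a function of
      \<open>J f {..<i} x\<close> almost everywhere, against \<open>P f i (f i)\<close>.\<close>
    have "\<exists>x y. J f UNIV x \<in> V \<and> J f UNIV y \<in> V \<and> J f {..<i} x = J f {..<i} y \<and> f i x \<noteq> f i y" for i
    proof (rule ccontr)
      assume same: "\<not> ?thesis"
      define g where "g s = f i (SOME x. J f UNIV x \<in> V \<and> J f {..<i} x = s)" for s
      have "\<forall>\<^sub>F x in F. f i x = g (J f {..<i} x)"
        using V(2)
      proof eventually_elim
        case (elim x)
        then show ?case
          using same someI[of "\<lambda>y. J f UNIV y \<in> V \<and> J f {..<i} y = J f {..<i} x" x]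
          unfolding g_def by metis
      qed
      then show False using f[of i] by (auto simp: P_def)
    qed
    then obtain X Y where XY: "\<And>i. J f UNIV (X i) \<in> V" "\<And>i. J f UNIV (Y i) \<in> V"
        "\<And>i. J f {..<i} (X i) = J f {..<i} (Y i)" "\<And>i. f i (X i) \<noteq> f i (Y i)"
      by metis
    define q where "q i = (J f UNIV (X i), J f UNIV (Y i))" for i
    \<comment> \<open>\<open>X j\<close> and \<open>Y j\<close> agree at the earlier index
      \<open>i\<close>; equal pairs would make \<open>X i\<close> and \<open>Y i\<close> agree there
      too.\<close>
    have "q i \<noteq> q j" if "i \<in> T" "j \<in> T" "i < j" for i j
    proof
      assume "q i = q j"
      then have "f i (X i) = f i (X j)" "f i (Y i) = f i (Y j)"
        using that(1) by (auto simp: q_def J_eq)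
      moreover have "f i (X j) = f i (Y j)"
        using that XY(3)[of j] by (simp add: J_eq)
      ultimately show False using XY(4)[of i] by simp
    qed
    then have "inj_on q T"
      by (intro linorder_inj_onI) auto
    then have "|T| \<le>o |V \<times> V|"
      using XY(1,2) by (intro card_of_ordLeqI[of q]) (auto simp: q_def)
    then show False
      using Times_below_T[OF V(1)] not_ordLess_ordLeq by blast
  qed
  then obtain p :: "'a \<Rightarrow> ('a \<times> 'a) set" where p: "|range p| <o |T|"
    "\<And>h::'a \<Rightarrow> 'a. range h \<subseteq> T \<Longrightarrow> \<exists>g. \<forall>\<^sub>F x in F. h x = g (p x)"
    by blast
  obtain e :: "('a \<times> 'a) set \<Rightarrow> 'a" where e: "inj_on e (range p)"
    using p(1) card_of_ordLeq[of "range p" T] ordLess_imp_ordLeq by blast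
  show thesis
  proof (rule that[of "e \<circ> p"])
    show "|range (e \<circ> p)| <o |T|"
      using p(1) card_of_image ordLeq_ordLess_trans by (metis image_comp)
    fix h :: "'a \<Rightarrow> 'a"
    assume "range h \<subseteq> T"
    then obtain g where "\<forall>\<^sub>F x in F. h x = g (p x)" using p(2) by blast
    then have "\<forall>\<^sub>F x in F. h x = (g \<circ> inv_into (range p) e) ((e \<circ> p) x)"
      by eventually_elim (simp add: e)
    then show "\<exists>g. \<forall>\<^sub>F x in F. h x = g ((e \<circ> p) x)" by blast
  qed
qed

section \<open>Existence of a least unbounded function\<close>

text \<open>Handles \<open>|T|\<close> many functions at once although \<open>F\<close> need not be
  closed under intersections of \<open>|T|\<close> many sets. The set of \<open>i\<close> in
  \<open>T\<close> with \<open>y < f i x\<close> has at most \<open>|Pow T|\<close> possible values,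
  so it factors through \<open>p\<close> and is coded by a relation \<open>R y\<close> on
  \<open>range p \<times> T\<close>.\<close>

lemma uniform_threshold:
  fixes f :: "'a \<Rightarrow> 'a \<Rightarrow> 'a"
  shows "\<exists>y. \<forall>z. \<forall>\<^sub>F x in F. \<forall>i\<in>T. y < f i x \<longrightarrow> z < f i x"
proof -
  obtain p :: "'a \<Rightarrow> 'a" where p: "|range p| <o |T|"
    "\<And>h::'a \<Rightarrow> 'a. range h \<subseteq> T \<Longrightarrow> \<exists>g. \<forall>\<^sub>F x in F. h x = g (p x)"
    using finest_partition by blast
  have "\<exists>R. R \<subseteq> range p \<times> T \<and> (\<forall>\<^sub>F x in F. \<forall>i\<in>T. y < f i x \<longleftrightarrow> (p x, i) \<in> R)" for y
  proof -
    define Z where "Z x = {i \<in> T. y < f i x}" for x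
    have "range Z \<subseteq> Pow T" by (auto simp: Z_def)
    then have "|range Z| <o |UNIV::'a set|"
      using Pow_T by (rule card_less_subset)
    then obtain g where "\<forall>\<^sub>F x in F. Z x = g (p x)"
      using factor_small_range[OF p(2)] by blast
    then have "\<forall>\<^sub>F x in F. \<forall>i\<in>T. y < f i x \<longleftrightarrow> (p x, i) \<in> {(s, i). s \<in> range p \<and> i \<in> T \<inter> g s}"
      by eventually_elim (auto simp: Z_def)
    then show ?thesis
      by (intro exI[of _ "{(s, i). s \<in> range p \<and> i \<in> T \<inter> g s}"]) auto
  qed
  then have "\<exists>R. \<forall>y. R y \<subseteq> range p \<times> T \<and> (\<forall>\<^sub>F x in F. \<forall>i\<in>T. y < f i x \<longleftrightarrow> (p x, i) \<in> R y)"
    by (intro choice allI)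
  then obtain R where R: "\<And>y. R y \<subseteq> range p \<times> T"
    "\<And>y. \<forall>\<^sub>F x in F. \<forall>i\<in>T. y < f i x \<longleftrightarrow> (p x, i) \<in> R y"
    by blast
  have "|range p \<times> T| \<le>o |T|"
    using p(1) infinite_T
    by (intro card_of_Times_ordLeq_infinite_Field[OF _ _ _ card_of_Card_order])
      (simp_all add: Field_card_of ordLess_imp_ordLeq card_of_mono1)
  then have small: "|Pow (range p \<times> T)| <o |UNIV::'a set|" by (rule Pow_small)
  txt \<open>R y decreases with y modulo F, so it is eventually constant once some value S recurs
    cofinally; there are too few possible values for this not to happen.\<close>
  have "\<exists>S. \<forall>y. \<exists>z\<ge>y. R z = S"
  proof (rule ccontr)
    assume "\<not> ?thesis"
    then have "\<forall>S. \<exists>b. \<forall>z\<ge>b. R z \<noteq> S" by simp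
    then have "\<exists>b. \<forall>S. \<forall>z\<ge>b S. R z \<noteq> S" by (rule choice)
    then obtain b where b: "\<And>S z. b S \<le> z \<Longrightarrow> R z \<noteq> S" by blast
    obtain y where "\<forall>S\<in>Pow (range p \<times> T). b S < y"
      using small_index_bounded[OF small] by blast
    then have "b (R y) < y" using R(1)[of y] by blast
    then show False using b[OF less_imp_le] by blast
  qed
  then obtain S where S: "\<And>y. \<exists>z\<ge>y. R z = S" by blast
  obtain y where y: "R y = S" using S by blast
  have "\<forall>\<^sub>F x in F. \<forall>i\<in>T. y < f i x \<longrightarrow> z < f i x" for z
  proof -
    obtain w where w: "z \<le> w" "R w = S" using S by blast
    show ?thesis
      using R(2)[of y] R(2)[of w] by eventually_elim (use y w in force)
  qed
  then show ?thesis by blast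
qed

lemma least_unbounded_function:
  obtains f :: "'a \<Rightarrow> 'a" where "\<And>y. \<forall>\<^sub>F x in F. y < f x"
    "\<And>g. \<forall>\<^sub>F x in F. g x < f x \<Longrightarrow> \<exists>y. \<forall>\<^sub>F x in F. g x \<le> y"
proof (rule ccontr)
  note thesisI = that
  assume none: "\<not> thesis"
  have smaller: "\<exists>g. (\<forall>\<^sub>F x in F. g x < f x) \<and> (\<forall>y. \<forall>\<^sub>F x in F. y < g x)"
    if unb: "\<And>y. \<forall>\<^sub>F x in F. y < f x" for f :: "'a \<Rightarrow> 'a"
  proof -
    obtain g where g: "\<forall>\<^sub>F x in F. g x < f x" "\<And>y. \<not> (\<forall>\<^sub>F x in F. g x \<le> y)"
      using none thesisI[OF unb] by blast
    have "\<forall>\<^sub>F x in F. y < g x" for y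
      using ultra[of "\<lambda>x. g x \<le> y"] g(2)[of y] by (simp add: not_le)
    with g(1) show ?thesis by blast
  qed
  txt \<open>Without a least unbounded function, recursion along T yields a sequence whose values at a
    fixed x decrease strictly along s x below, so that each s x is finite.\<close>
  define P where "P f i r \<longleftrightarrow> (\<forall>y. \<forall>\<^sub>F x in F. y < r x) \<and>
      (\<exists>y. \<forall>\<^sub>F x in F. \<forall>j\<in>T. j < i \<longrightarrow> y < f j x \<longrightarrow> r x < f j x)"
    for f :: "'a \<Rightarrow> 'a \<Rightarrow> 'a" and i and r :: "'a \<Rightarrow> 'a"
  have "\<exists>f. \<forall>i. P f i (f i)"
  proof (rule dependent_wf_choice[OF wf])
    fix f f' :: "'a \<Rightarrow> 'a \<Rightarrow> 'a" and i r
    assume "\<And>j. (j, i) \<in> {(x, y). x < y} \<Longrightarrow> f j = f' j"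
    then show "P f i r = P f' i r" by (simp add: P_def cong: imp_cong)
  next
    fix i and f :: "'a \<Rightarrow> 'a \<Rightarrow> 'a"
    obtain y where y: "\<And>z. \<forall>\<^sub>F x in F. \<forall>j\<in>T. y < f j x \<longrightarrow> z < f j x"
      using uniform_threshold by blast
    define S where "S x = {f j x | j. j \<in> T \<and> j < i \<and> y < f j x}" for x
    \<comment> \<open>The least earlier value above the threshold. By the choice of \<open>y\<close>
      it is unbounded modulo \<open>F\<close>; the default \<open>x\<close> is unbounded as well.
      Anything below \<open>m\<close> is below all these values simultaneously.\<close>
    define m where "m x = (if S x = {} then x else LEAST v. v \<in> S x)" for x
    have m_in: "m x \<in> S x" if "S x \<noteq> {}" for x
      using that by (auto simp: m_def intro: LeastI)
    have m_le: "m x \<le> v" if "v \<in> S x" for x v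
      using that by (auto simp: m_def intro: Least_le)
    have "\<forall>\<^sub>F x in F. z < m x" for z
      using y[of z] unbounded[of z]
    proof eventually_elim
      case (elim x)
      show ?case
      proof (cases "S x = {}")
        case True
        then show ?thesis using elim by (simp add: m_def)
      next
        case False
        then show ?thesis using elim m_in[of x] by (auto simp: S_def)
      qed
    qed
    then obtain g where g: "\<forall>\<^sub>F x in F. g x < m x" "\<And>z. \<forall>\<^sub>F x in F. z < g x"
      using smaller by blast
    have "\<forall>\<^sub>F x in F. \<forall>j\<in>T. j < i \<longrightarrow> y < f j x \<longrightarrow> g x < f j x"
      using g(1)
    proof eventually_elim
      case (elim x)
      then show ?case using m_le[of _ x] unfolding S_def by (fastforce intro: less_le_trans)
    qed
    then show "\<exists>r. P f i r" using g(2) by (auto simp: P_def)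
  qed
  then obtain f where P: "\<And>i. P f i (f i)" by blast
  have "\<exists>b. \<forall>i. \<forall>\<^sub>F x in F. \<forall>j\<in>T. j < i \<longrightarrow> b i < f j x \<longrightarrow> f i x < f j x"
    using P by (intro choice) (simp add: P_def)
  with P obtain b where f: "\<And>i y. \<forall>\<^sub>F x in F. y < f i x"
    "\<And>i. \<forall>\<^sub>F x in F. \<forall>j\<in>T. j < i \<longrightarrow> b i < f j x \<longrightarrow> f i x < f j x"
    unfolding P_def by blast
  \<comment> \<open>One bound for all thresholds: the clause \<open>c < f i x\<close> in
    \<open>A i\<close> then activates the comparison with every later index in
    \<open>T\<close>.\<close>
  obtain c where c: "\<And>i. i \<in> T \<Longrightarrow> b i < c"
    using small_index_bounded[OF T_less] by blast
  define A where "A i = {x. c < f i x \<and> (\<forall>j\<in>T. j < i \<longrightarrow> b i < f j x \<longrightarrow> f i x < f j x)}" for i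
  define s where "s x = {i \<in> T. x \<in> A i}" for x
  have finite_s: "finite (s x)" for x
  proof (rule finite_if_strictly_decreasing)
    fix i j
    assume "i \<in> s x" "j \<in> s x" "i < j"
    then show "f j x < f i x"
      using c[of j] by (auto simp: s_def A_def)
  qed
  have "range s \<subseteq> Pow T" by (auto simp: s_def)
  then have "|range s| <o |UNIV::'a set|"
    using Pow_T by (rule card_less_subset)
  then obtain V where V: "|V| <o |T|" "V \<subseteq> range s" "\<forall>\<^sub>F x in F. s x \<in> V"
    by (rule few_values)
  have "stable |T|"
    using infinite_T regular_T
    by (intro regularCard_stable[OF card_of_Card_order]) (simp_all add: Field_card_of)
  then have "|\<Union>v\<in>V. v| <o |T|"
  proof (rule stable_UNION[OF _ V(1)])
    fix v assume "v \<in> V"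
    then show "|v| <o |T|"
      using V(2) finite_s infinite_T by (auto intro: finite_card_less)
  qed
  \<comment> \<open>Fewer than \<open>|T|\<close> finite sets cannot cover \<open>T\<close>. An
    uncovered \<open>t\<close> contradicts \<open>A t\<close> holding almost everywhere, which puts
    \<open>t\<close> into \<open>s x\<close>.\<close>
  then have "\<not> T \<subseteq> \<Union>V"
    using card_of_mono1 not_ordLess_ordLeq by fastforce
  then obtain t where t: "t \<in> T" "t \<notin> \<Union>V" by blast
  have "\<forall>\<^sub>F x in F. x \<in> A t"
    using f(1)[of c t] f(2)[of t] by eventually_elim (simp add: A_def)
  then have "\<forall>\<^sub>F x in F. False"
    using V(3) by eventually_elim (use t in \<open>auto simp: s_def\<close>)
  then show False using nontrivial by simp
qed

section \<open>Closure points of cofinality theta\<close>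

text \<open>\<open>c\<close> is the supremum of a strictly increasing sequence of length theta whose
  later terms exceed the \<open>e\<close>-images of earlier ones; regularity of theta bounds small
  subsets of \<open>c\<close> by a term.\<close>

lemma closure_point:
  fixes e :: "'a \<Rightarrow> 'a"
  shows "\<exists>c>a. \<forall>S. S \<subseteq> {..<c} \<longrightarrow> |S| <o |T| \<longrightarrow> (\<exists>d<c. (\<forall>s\<in>S. s < d) \<and> e d < c)"
proof -
  \<comment> \<open>Indices follow the cardinal order \<open>|T|\<close>, to which
    \<open>regular_T\<close> refers; the order that \<open>T\<close> inherits from the type may be
    longer.\<close>
  define R where "R = |T| - Id"
  define P where "P f i r \<longleftrightarrow> a < r \<and> (\<forall>j\<in>T. (j, i) \<in> R \<longrightarrow> f j < r \<and> e (f j) < r)"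
    for f and i r :: 'a
  have wo: "Well_order |T|" by (rule card_of_Well_order)
  have "\<exists>f. \<forall>i. P f i (f i)"
  proof (rule dependent_wf_choice)
    show "wf R" using wo by (simp add: R_def well_order_on_def)
  next
    fix f f' :: "'a \<Rightarrow> 'a" and i r
    assume "\<And>j. (j, i) \<in> R \<Longrightarrow> f j = f' j"
    then show "P f i r = P f' i r" by (auto simp: P_def)
  next
    fix i and f :: "'a \<Rightarrow> 'a"
    obtain u where u: "\<forall>j\<in>T. f j < u" using small_index_bounded[OF T_less] by blast
    obtain v where v: "\<forall>j\<in>T. e (f j) < v"
      using small_index_bounded[OF T_less, of "e \<circ> f"] by auto
    obtain w where "a < w" using exists_greater by blast
    then have "P f i (max w (max u v))"
      using u v by (auto simp: P_def less_max_iff_disj)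
    then show "\<exists>r. P f i r" by blast
  qed
  then obtain f where P: "\<And>i. P f i (f i)" by blast
  then have f: "a < f i" "j \<in> T \<Longrightarrow> (j, i) \<in> R \<Longrightarrow> f j < f i"
    "j \<in> T \<Longrightarrow> (j, i) \<in> R \<Longrightarrow> e (f j) < f i" for i j
    unfolding P_def by blast+
  define c where "c = (LEAST c. \<forall>i\<in>T. f i < c)"
  have c: "f i < c" if "i \<in> T" for i
    using that LeastI_ex[OF small_index_bounded[OF T_less, of f]] by (auto simp: c_def)
  have below_c: "\<exists>i\<in>T. s \<le> f i" if "s < c" for s
    using not_less_Least[of s "\<lambda>c. \<forall>i\<in>T. f i < c"] that by (auto simp: c_def not_less)
  have next_in: "\<exists>j\<in>T. (i, j) \<in> R" if "i \<in> T" for i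
    using infinite_Card_order_limit[OF card_of_Card_order, of T i] infinite_T that
    by (auto simp: Field_card_of R_def)
  have "\<exists>d<c. (\<forall>s\<in>S. s < d) \<and> e d < c" if S: "S \<subseteq> {..<c}" "|S| <o |T|" for S
  proof -
    have "\<forall>s\<in>S. \<exists>i. i \<in> T \<and> s \<le> f i" using below_c S(1) by blast
    then have "\<exists>k. \<forall>s\<in>S. k s \<in> T \<and> s \<le> f (k s)" by (rule bchoice)
    then obtain k where k: "\<And>s. s \<in> S \<Longrightarrow> k s \<in> T" "\<And>s. s \<in> S \<Longrightarrow> s \<le> f (k s)" by blast
    have "|k ` S| <o |T|"
      using card_of_image S(2) ordLeq_ordLess_trans by blast
    then have "\<not> |k ` S| =o |T|"
      using not_ordLess_ordIso by blast
    moreover have "k ` S \<subseteq> T" using k(1) by blast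
    ultimately have "\<not> cofinal (k ` S) |T|"
      using regular_T unfolding regularCard_def Field_card_of by blast
    then have "\<exists>i\<in>T. \<forall>s\<in>S. i = k s \<or> (i, k s) \<notin> |T|"
      by (simp add: cofinal_def Field_card_of)
    then obtain i where i: "i \<in> T" "\<And>s. s \<in> S \<Longrightarrow> i = k s \<or> (i, k s) \<notin> |T|"
      by blast
    obtain j where j: "j \<in> T" "(i, j) \<in> R" using next_in i(1) by blast
    \<comment> \<open>Every \<open>k s\<close> is at or before \<open>i\<close>, so
      \<open>f j\<close> at the next index lies strictly above \<open>S\<close>; the further index
      \<open>l\<close> keeps \<open>e (f j)\<close> below \<open>c\<close>.\<close>
    obtain l where l: "l \<in> T" "(j, l) \<in> R" using next_in j(1) by blast
    have lin: "total_on T |T|" "trans |T|" "antisym |T|"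
      using wo by (simp_all add: order_on_defs well_order_on_def Field_card_of)
    have "s < f j" if s: "s \<in> S" for s
    proof -
      have "(k s, j) \<in> R"
      proof (cases "k s = i")
        case True
        then show ?thesis using j by simp
      next
        case False
        then have "(k s, i) \<in> |T|"
          using lin(1) i s k(1)[OF s] unfolding total_on_def by metis
        moreover have "(i, j) \<in> |T|" using j(2) by (simp add: R_def)
        ultimately have "(k s, j) \<in> |T|" using lin(2) by (blast dest: transD)
        moreover have "k s \<noteq> j" using i(2)[OF s] j(2) False by (auto simp: R_def)
        ultimately show ?thesis by (simp add: R_def)
      qed
      then have "f (k s) < f j" by (rule f(2)[OF k(1)[OF s]])
      with k(2)[OF s] show ?thesis by (rule le_less_trans)
    qed
    moreover have "f j < c" using c[OF j(1)] .
    moreover have "e (f j) < c" using f(3)[OF j(1) l(2)] c[OF l(1)] by (rule less_trans)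
    ultimately show ?thesis by (intro exI[of _ "f j"]) simp
  qed
  moreover have "a < c"
  proof -
    obtain i where "i \<in> T" using infinite_T by fastforce
    show ?thesis using f(1)[of i] c[OF \<open>i \<in> T\<close>] by (rule less_trans)
  qed
  ultimately show ?thesis by (intro exI[of _ c]) simp
qed

end

section \<open>Weak normality\<close>

text \<open>Together with \<open>unbounded\<close> this says that the identity is a least unbounded
  function modulo \<open>F\<close>.\<close>

locale weakly_normal_filter = indecomposable_filter +
  assumes weakly_normal: "\<forall>\<^sub>F x in F. g x < x \<Longrightarrow> \<exists>y. \<forall>\<^sub>F x in F. g x \<le> y"

text \<open>A regressive \<open>g\<close> for the image filter gives \<open>g \<circ> f\<close>
  below the least unbounded \<open>f\<close>, hence bounded. The other properties pull back along
  \<open>f\<close>.\<close>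

lemma (in indecomposable_filter) weakly_normal_pushforward:
  "\<exists>f. weakly_normal_filter T (filtermap f F)"
proof (rule least_unbounded_function)
  fix f :: "'a \<Rightarrow> 'a"
  assume f: "\<And>y. \<forall>\<^sub>F x in F. y < f x"
    "\<And>g. \<forall>\<^sub>F x in F. g x < f x \<Longrightarrow> \<exists>y. \<forall>\<^sub>F x in F. g x \<le> y"
  have "weakly_normal_filter T (filtermap f F)"
  proof unfold_locales
    fix M :: "'a set" and h :: "'a \<Rightarrow> 'a"
    assume "|T| \<le>o |M|" "|M| <o |UNIV::'a set|" "range h \<subseteq> M"
    then show "\<exists>H. |H| <o |M| \<and> (\<forall>\<^sub>F x in filtermap f F. h x \<in> H)"
      using indecomposable[of M "h \<circ> f"] by (auto simp: eventually_filtermap)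
  next
    fix g :: "'a \<Rightarrow> 'a"
    assume "\<forall>\<^sub>F x in filtermap f F. g x < x"
    then show "\<exists>y. \<forall>\<^sub>F x in filtermap f F. g x \<le> y"
      using f(2)[of "g \<circ> f"] by (simp add: eventually_filtermap)
  next
    fix P
    show "(\<forall>\<^sub>F x in filtermap f F. P x) \<or> (\<forall>\<^sub>F x in filtermap f F. \<not> P x)"
      using ultra by (simp add: eventually_filtermap)
  qed (use f(1) in \<open>simp_all add: eventually_filtermap filtermap_bot_iff kappa infinite_T
    regular_T Pow_T nontrivial\<close>)
  then show ?thesis by blast
qed

section \<open>Accumulation points and covers for transversals\<close>

lemma transversalE:
  fixes C :: "'a::wellorder \<Rightarrow> 'a set"
  assumes "transversal C"
  obtains CC where "\<And>a. |CC a| <o |UNIV::'a set|" "\<And>a. closed_below (C a) a"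
    "\<And>a. osup (C a) = osup_ord a" "\<And>a b. b \<in> acc (C a) \<Longrightarrow> {x \<in> C a. x < b} \<in> CC b"
  using assms unfolding transversal_def square_seq_def by blast

context weakly_normal_filter
begin

lemma eventually_transversal_meets:
  assumes "transversal C"
  shows "\<forall>\<^sub>F b in F. \<exists>c\<in>C b. a \<le> c"
proof -
  \<comment> \<open>For \<open>b\<close> above \<open>u\<close>, the supremum of \<open>b\<close>,
    hence of \<open>C b\<close>, is at least \<open>u\<close>, even at successors; so
    \<open>a\<close> cannot bound \<open>C b\<close>.\<close>
  obtain u where u: "a < u" using exists_greater by blast
  show ?thesis
    using unbounded[of u]
  proof eventually_elim
    case (elim b)
    have "u \<le> osup_ord b"
      unfolding osup_ord_def using elim by (intro osup_upper[of _ _ b]) auto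
    also have "\<dots> = osup (C b)"
      using assms by (rule transversalE) simp
    finally show ?case
      using u osup_le[of "C b" a] by (meson leD le_cases order.strict_trans2)
  qed
qed

text \<open>The least element of \<open>C b\<close> at or above \<open>a\<close> is regressive in
  \<open>b\<close>, so weak normality bounds it.\<close>

lemma transversal_meets_interval:
  assumes "transversal C"
  shows "\<exists>y. \<forall>\<^sub>F b in F. \<exists>c\<in>C b. a \<le> c \<and> c \<le> y"
proof -
  define g where "g b = (LEAST c. c \<in> C b \<and> a \<le> c)" for b
  have g: "\<forall>\<^sub>F b in F. g b \<in> C b \<and> a \<le> g b"
    using eventually_transversal_meets[OF assms, of a]
  proof eventually_elim
    case (elim b)
    then have "\<exists>c. c \<in> C b \<and> a \<le> c" by blast
    then show ?case unfolding g_def by (rule LeastI_ex)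
  qed
  have below: "C b \<subseteq> {x. x < b}" for b
    using assms by (rule transversalE) (simp add: closed_below_def)
  have "\<forall>\<^sub>F b in F. g b < b"
    using g by eventually_elim (use below in blast)
  then obtain y where "\<forall>\<^sub>F b in F. g b \<le> y"
    using weakly_normal by blast
  with g have "\<forall>\<^sub>F b in F. \<exists>c\<in>C b. a \<le> c \<and> c \<le> y"
    by eventually_elim blast
  then show ?thesis by blast
qed

text \<open>Take a closure point \<open>c\<close> of the interval bounds \<open>e\<close>. If
  \<open>C b\<close> were bounded in \<open>c\<close> almost everywhere, its suprema would
  concentrate on fewer than theta ordinals below some \<open>d < c\<close>, yet \<open>C b\<close>
  meets the interval from \<open>d\<close> to \<open>e d\<close>, still below
  \<open>c\<close>.\<close>

lemma eventually_acc:
  assumes C: "transversal C"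
  shows "\<exists>c>a. \<forall>\<^sub>F b in F. c \<in> acc (C b)"
proof -
  have "\<exists>e. \<forall>a. \<forall>\<^sub>F b in F. \<exists>c\<in>C b. a \<le> c \<and> c \<le> e a"
    by (intro choice allI transversal_meets_interval[OF C])
  then obtain e where e: "\<And>a. \<forall>\<^sub>F b in F. \<exists>c\<in>C b. a \<le> c \<and> c \<le> e a" by blast
  obtain c where c: "a < c"
    "\<And>S. S \<subseteq> {..<c} \<Longrightarrow> |S| <o |T| \<Longrightarrow> \<exists>d<c. (\<forall>s\<in>S. s < d) \<and> e d < c"
    using closure_point[of a e] by blast
  define s where "s b = osup {x \<in> C b. x < c}" for b
  have acc: "c \<in> acc (C b)" if "c < b" "s b = c" for b
  proof -
    have "ozero < c" using c(1) Least_le[of "\<lambda>_. True" a] by (auto simp: ozero_def)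
    moreover have "closed_below (C b) b" using C by (rule transversalE)
    ultimately show ?thesis using that by (auto simp: closed_below_def acc_def s_def)
  qed
  have s_le: "s b \<le> c" for b unfolding s_def by (rule osup_le) (simp add: less_imp_le)
  have "\<forall>\<^sub>F b in F. s b = c"
  proof (rule ccontr)
    assume "\<not> ?thesis"
    then have ne: "\<forall>\<^sub>F b in F. s b \<noteq> c" using ultra[of "\<lambda>b. s b = c"] by blast
    \<comment> \<open>The default \<open>a\<close> keeps all values strictly below
      \<open>c\<close>.\<close>
    define h where "h b = (if s b = c then a else s b)" for b
    have h: "range h \<subseteq> {..<c}"
      using c(1) s_le by (auto simp: h_def le_less)
    then have "|range h| <o |UNIV::'a set|"
      by (rule card_less_subset) (use kappa in \<open>simp add: kappa_type_def lessThan_def\<close>)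
    then obtain V where V: "|V| <o |T|" "V \<subseteq> range h" "\<forall>\<^sub>F b in F. h b \<in> V"
      by (rule few_values)
    obtain d where d: "d < c" "\<forall>s\<in>V. s < d" "e d < c"
      using c(2)[OF subset_trans[OF V(2) h] V(1)] by blast
    have "\<forall>\<^sub>F b in F. False"
      using V(3) ne e[of d]
    proof eventually_elim
      case (elim b)
      then obtain x where x: "x \<in> C b" "d \<le> x" "x \<le> e d" by blast
      have "x \<le> s b"
        unfolding s_def using x d(3) by (intro osup_upper[of _ _ c]) auto
      moreover have "s b < d" using elim d(2) by (auto simp: h_def)
      ultimately show ?case using x(2) by simp
    qed
    then show False using nontrivial by simp
  qed
  with unbounded[of c] have "\<forall>\<^sub>F b in F. c \<in> acc (C b)"
    by eventually_elim (rule acc)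
  then show ?thesis using c(1) by blast
qed

lemma transversal_cover:
  fixes p :: "'a \<Rightarrow> 'a"
  assumes p: "\<And>h::'a \<Rightarrow> 'a. range h \<subseteq> T \<Longrightarrow> \<exists>g. \<forall>\<^sub>F x in F. h x = g (p x)"
    and C: "transversal C"
  shows "\<exists>B. |B| \<le>o |range p| \<and>
    {x. x < a \<and> (\<forall>\<^sub>F b in F. x \<in> acc (C b))} \<subseteq> (\<Union>b\<in>B. C b)"
proof -
  obtain CC where CC: "\<And>a. |CC a| <o |UNIV::'a set|"
    "\<And>a b. b \<in> acc (C a) \<Longrightarrow> {x \<in> C a. x < b} \<in> CC b"
    using C by (rule transversalE) blast
  obtain c where c: "a < c" "\<forall>\<^sub>F b in F. c \<in> acc (C b)"
    using eventually_acc[OF C] by blast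
  txt \<open>The traces of the sets C b on c lie in a family of size less than kappa, so they factor
    through p and one representative b for each value of p suffices.\<close>
  define h where "h b = (if c \<in> acc (C b) then {x \<in> C b. x < c} else {})" for b
  \<comment> \<open>Coherence puts the trace into \<open>CC c\<close> when \<open>c\<close>
    accumulates \<open>C b\<close>; \<open>{}\<close> is the default value.\<close>
  have "range h \<subseteq> CC c \<union> {{}}"
    using CC(2) by (auto simp: h_def)
  moreover have "|CC c \<union> {{}}| <o |UNIV::'a set|"
    by (intro card_of_Un_ordLess_infinite infinite_UNIV CC(1) finite_card_less) simp
  ultimately have "|range h| <o |UNIV::'a set|" by (rule card_less_subset)
  then obtain g where g: "\<forall>\<^sub>F b in F. h b = g (p b)"
    using factor_small_range[OF p] by blast
  define A where "A = {b. c \<in> acc (C b) \<and> h b = g (p b)}"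
  have A: "\<forall>\<^sub>F b in F. b \<in> A"
    using c(2) g by eventually_elim (simp add: A_def)
  define B where "B = inv_into A p ` p ` A"
  have "|B| \<le>o |p ` A|" unfolding B_def by (rule card_of_image)
  moreover have "|p ` A| \<le>o |range p|" by (rule card_of_mono1) blast
  ultimately have "|B| \<le>o |range p|" by (rule ordLeq_transitive)
  moreover have "x \<in> (\<Union>b\<in>B. C b)" if x: "x < a" "\<forall>\<^sub>F b in F. x \<in> acc (C b)" for x
  proof -
    have "\<forall>\<^sub>F b in F. b \<in> A \<and> x \<in> acc (C b)"
      using A x(2) by (rule eventually_conj)
    then obtain b where b: "b \<in> A" "x \<in> acc (C b)"
      using eventually_happens nontrivial by blast
    \<comment> \<open>The representative has the same trace on \<open>c\<close> as \<open>b\<close>,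
      so it also contains \<open>x\<close>.\<close>
    define b' where "b' = inv_into A p (p b)"
    have b': "b' \<in> A" "p b' = p b"
      using b(1) unfolding b'_def by (auto intro: inv_into_into f_inv_into_f)
    then have "h b' = h b" "c \<in> acc (C b')" "c \<in> acc (C b)"
      using b(1) by (simp_all add: A_def)
    then have "{x \<in> C b'. x < c} = {x \<in> C b. x < c}" by (simp add: h_def)
    moreover have "x \<in> C b" "x < c" using b(2) x(1) c(1) by (auto simp: acc_def)
    ultimately have "x \<in> C b'" by blast
    moreover have "b' \<in> B" using b(1) by (auto simp: B_def b'_def)
    ultimately show ?thesis by blast
  qed
  ultimately show ?thesis by blast
qed

lemma uniform_chi_le: "\<exists>M::'a set. |M| <o |T| \<and> (\<forall>C. transversal C \<longrightarrow> chi_le C M)"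
proof -
  obtain p :: "'a \<Rightarrow> 'a" where p: "|range p| <o |T|"
    "\<And>h::'a \<Rightarrow> 'a. range h \<subseteq> T \<Longrightarrow> \<exists>g. \<forall>\<^sub>F x in F. h x = g (p x)"
    using finest_partition by blast
  have "chi_le C (range p)" if C: "transversal C" for C
  proof -
    \<comment> \<open>\<open>D\<close> serves as \<open>Delta\<close>; it is unbounded, hence of
      size kappa. Since \<open>p\<close> was fixed before \<open>C\<close>, the bound is
      uniform.\<close>
    define D where "D = {x. \<forall>\<^sub>F b in F. x \<in> acc (C b)}"
    have "\<exists>x\<in>D. y \<le> x" for y
      using eventually_acc[OF C, of y] unfolding D_def by (blast intro: less_imp_le)
    then have "|D| =o |UNIV::'a set|" by (rule unbounded_full)
    moreover have "\<exists>B. |B| =o |range p| \<and> {x \<in> D. x < a} \<subseteq> (\<Union>b\<in>B. C b)" for a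
    proof -
      obtain B where B: "|B| \<le>o |range p|" "{x \<in> D. x < a} \<subseteq> (\<Union>b\<in>B. C b)"
        using transversal_cover[OF p(2) C, of a] by (auto simp: D_def conj_commute)
      obtain B' where "B \<subseteq> B'" "|B'| =o |range p|"
        using superset_of_cardinality[OF B(1) infinite_UNIV] by blast
      then show ?thesis using B(2) by blast
    qed
    then have "\<exists>b. \<forall>a. |b a| =o |range p| \<and> {x \<in> D. x < a} \<subseteq> (\<Union>\<beta>\<in>b a. C \<beta>)"
      by (intro choice allI)
    ultimately have "chi_witness C (range p)" unfolding chi_witness_def by blast
    then show ?thesis unfolding chi_le_def using card_of_mono1 by blast
  qed
  then show ?thesis using p(1) by blast
qed

end

section \<open>From the given ultrafilter to the filter setting\<close>

lemma indecomposable_filter_of_ultrafilter: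
  fixes T :: "'a::wellorder set"
  assumes kappa: "kappa_type TYPE('a)" and T: "infinite T" "regularCard |T|"
    and Pow: "|Pow T| <o |UNIV::'a set|" and U: "uniform_uf U"
    and indec: "\<And>M::'a set. |T| \<le>o |M| \<Longrightarrow> |M| <o |UNIV::'a set| \<Longrightarrow> indecomposable U M"
  shows "indecomposable_filter T (Abs_filter (\<lambda>P. {x. P x} \<in> U))"
proof -
  let ?F = "Abs_filter (\<lambda>P. {x. P x} \<in> U)"
  have uf: "UNIV \<in> U" "{} \<notin> U" "\<And>A B. A \<in> U \<Longrightarrow> A \<subseteq> B \<Longrightarrow> B \<in> U"
    "\<And>A B. A \<in> U \<Longrightarrow> B \<in> U \<Longrightarrow> A \<inter> B \<in> U" "\<And>A. A \<in> U \<or> - A \<in> U"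
    using U unfolding uniform_uf_def ultrafilter_on_def by blast+
  have full: "|A| =o |UNIV::'a set|" if "A \<in> U" for A
    using U that by (simp add: uniform_uf_def)
  have "is_filter (\<lambda>P. {x. P x} \<in> U)"
  proof
    show "{x. P x \<and> Q x} \<in> U" if "{x. P x} \<in> U" "{x. Q x} \<in> U" for P Q
      using uf(4)[OF that] by (simp add: Collect_conj_eq)
    show "{x. Q x} \<in> U" if "\<forall>x. P x \<longrightarrow> Q x" "{x. P x} \<in> U" for P Q
      using uf(3)[OF that(2)] that(1) by blast
  qed (use uf(1) in simp)
  then have ev: "eventually P ?F \<longleftrightarrow> {x. P x} \<in> U" for P
    by (rule eventually_Abs_filter)
  show ?thesis
  proof
    show "?F \<noteq> bot"
      using uf(2) ev[of "\<lambda>_. False"] by (auto simp: trivial_limit_def)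
    show "eventually P ?F \<or> eventually (\<lambda>x. \<not> P x) ?F" for P
      using uf(5)[of "{x. P x}"] by (simp add: ev Collect_neg_eq)
    show "eventually (\<lambda>x. y < x) ?F" for y
    proof -
      \<comment> \<open>The complement is an initial segment of size less than kappa, which
        uniformity excludes from \<open>U\<close>.\<close>
      have "|insert y {x. x < y}| <o |UNIV::'a set|"
        using kappa card_of_Un_ordLess_infinite[of "UNIV::'a set" "{y}" "{x. x < y}"]
          finite_card_less[of "{y}" "UNIV::'a set"]
        by (simp add: kappa_type_def)
      moreover have "insert y {x. x < y} = - {x. y < x}" by auto
      ultimately have "- {x. y < x} \<notin> U"
        using full not_ordLess_ordIso by metis
      then show ?thesis using uf(5) by (auto simp: ev)
    qed
    show "\<exists>H::'a set. |H| <o |M| \<and> eventually (\<lambda>x. f x \<in> H) ?F"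
      if "|T| \<le>o |M|" "|M| <o |UNIV::'a set|" "range f \<subseteq> M" for M :: "'a set" and f :: "'a \<Rightarrow> 'a"
      using indec[OF that(1,2)] that(3) unfolding indecomposable_def by (fastforce simp: ev vimage_def)
  qed (use kappa T Pow in simp_all)
qed

theorem theorem4p5:
  fixes T :: "'a::wellorder set" and U :: "'a set set"
  assumes "kappa_type TYPE('a)"
    and "infinite T" and "regularCard |T|"
    and "|Pow T| <o |(UNIV::'a set)|"
    and "uniform_uf U"
    and "\<forall>M::'a set. |T| \<le>o |M| \<and> |M| <o |(UNIV::'a set)| \<longrightarrow> indecomposable U M"
  shows "\<exists>M::'a set. |M| <o |T| \<and> (\<forall>C. transversal C \<longrightarrow> chi_le C M)"
proof -
  interpret indecomposable_filter T "Abs_filter (\<lambda>P. {x. P x} \<in> U)"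
    using assms by (intro indecomposable_filter_of_ultrafilter) blast+
  \<comment> \<open>The conclusion does not mention the ultrafilter, so it may be proved from the
    image filter.\<close>
  obtain f where "weakly_normal_filter T (filtermap f (Abs_filter (\<lambda>P. {x. P x} \<in> U)))"
    using weakly_normal_pushforward by blast
  then interpret weakly_normal_filter T "filtermap f (Abs_filter (\<lambda>P. {x. P x} \<in> U))" .
  show ?thesis by (rule uniform_chi_le)
qed

end
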